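(* For every natural number $n$, the $4n\times 2n$ matrix $B=B^{(n)}$ defined in the context satisfies: (1) The columns of $B$ are orthogonal and the square sum of the coefficients (the sum of the squared moduli of the entries) of every column equals $2$. (2) The square sum of the coefficients of every row of $B$ equals $1$. Moreover, the row vectors of the matrices $B^{(n)}$ are not $(\delta,2)$-Rieszable for any $\delta$ independent of $n$; that is, there is no $\delta>0$ such that for every $n$ the family of the $4n$ row vectors of $B^{(n)}$, as elements of $\mathbb{C}^{2n}$, is $(\delta,2)$-Rieszable.
   Context: For $m\in\mathbb{N}$ let $\omega$ be a primitive $m$-th root of unity and let $DFT_{m\times m}=\left(\frac{1}{\sqrt{m}}\omega^{ij}\right)_{i,j=1}^m$, a unitary matrix. Construction of $B=B^{(n)}$: let $B_1$ be the $2n\times 2n$ matrix obtained from $DFT_{2n\times 2n}$ by multiplying each of the first $n-1$ columns by $\sqrt{2}$ and each of the remaining $n+1$ columns by $\sqrt{\frac{2}{n+1}}$. Let $B_2$ be the $2n\times 2n$ matrix obtained from $DFT_{2n\times 2n}$ by multiplying each of the first $n-1$ columns by $0$ and each of the remaining $n+1$ columns by $\sqrt{\frac{2n}{n+1}}$. Then $B$ is the $4n\times 2n$ matrix obtained by stacking $B_1$ on top of $B_2$. A family of vectors $\{f_i\}_{i=1}^M$ in a finite-dimensional Hilbert space is $(\delta,r)$-Rieszable if there is a partition $\{A_j\}_{j=1}^r$ of $\{1,\ldots,M\}$ (parts are allowed to be empty) so that for all $j=1,\ldots,r$ and all scalars $\{a_i\}_{i\in A_j}$ we have $\|\sum_{i\in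 A_j}a_if_i\|^2\ge\delta\sum_{i\in A_j}|a_i|^2$. *)

theory Defs
  imports
    "HOL-Analysis.Analysis"
    "HOL-Library.Disjoint_Sets"
    "Jordan_Normal_Form.Gram_Schmidt"
begin

definition primitive_root_unity :: "nat \<Rightarrow> complex \<Rightarrow> bool" where
  "primitive_root_unity m w \<longleftrightarrow> w ^ m = 1 \<and> (\<forall>k. 0 < k \<and> k < m \<longrightarrow> w ^ k \<noteq> 1)"

(* Matrix indices start at 0, so position (i, j) below is the entry with
   mathematical indices (i + 1, j + 1). *)
definition DFT :: "nat \<Rightarrow> complex \<Rightarrow> complex mat" where
  "DFT m w = mat m m (\<lambda>(i, j). complex_of_real (1 / sqrt (real m)) * w ^ ((i + 1) * (j + 1)))"

definition scale_cols :: "(nat \<Rightarrow> real) \<Rightarrow> complex mat \<Rightarrow> complex mat" where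
  "scale_cols c A = mat (dim_row A) (dim_col A) (\<lambda>(i, j). complex_of_real (c j) * A $$ (i, j))"

(* In B1, B2 and Bmat, w is meant to be a primitive root of unity of order 2n. *)
definition B1 :: "nat \<Rightarrow> complex \<Rightarrow> complex mat" where
  "B1 n w = scale_cols (\<lambda>j. if j < n - 1 then sqrt 2 else sqrt (2 / (real n + 1))) (DFT (2 * n) w)"

definition B2 :: "nat \<Rightarrow> complex \<Rightarrow> complex mat" where
  "B2 n w = scale_cols (\<lambda>j. if j < n - 1 then 0 else sqrt (2 * real n / (real n + 1))) (DFT (2 * n) w)"

definition Bmat :: "nat \<Rightarrow> complex \<Rightarrow> complex mat" where
  "Bmat n w = B1 n w @\<^sub>r B2 n w"

lemma Bmat_carrier: "Bmat n w \<in> carrier_mat (4 * n) (2 * n)"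
  unfolding Bmat_def B1_def B2_def scale_cols_def DFT_def append_rows_def carrier_mat_def
  by simp

definition norm_sq :: "complex vec \<Rightarrow> real" where
  "norm_sq v = (\<Sum>i<dim_vec v. (cmod (v $ i))\<^sup>2)"

(* The family is f 0, ..., f (M - 1) in the space of complex vectors of dimension d.
   Some parts A j may be empty; the scalars a i with i outside A j play no role. *)
definition rieszable :: "nat \<Rightarrow> nat \<Rightarrow> (nat \<Rightarrow> complex vec) \<Rightarrow> real \<Rightarrow> nat \<Rightarrow> bool" where
  "rieszable d M f \<delta> r \<longleftrightarrow>
    (\<exists>A :: nat \<Rightarrow> nat set.
      (\<Union>j<r. A j) = {..<M} \<and> disjoint_family_on A {..<r} \<and>
      (\<forall>j<r. \<forall>a :: nat \<Rightarrow> complex.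
        norm_sq (finsum_vec TYPE(complex) d (\<lambda>i. a i \<cdot>\<^sub>v f i) (A j))
          \<ge> \<delta> * (\<Sum>i\<in>A j. (cmod (a i))\<^sup>2)))"

end

theory Submission
  imports Defs
begin

text \<open>
  Both blocks of \<^term>\<open>Bmat n w\<close> arise from one unitary matrix \<open>D\<close>, the discrete Fourier
  transform of order \<open>2n\<close>, by scaling the columns; write \<open>c\<^sub>j\<close> and \<open>d\<^sub>j\<close> for the factors in the
  upper and the lower block. The columns of \<open>D\<close> stay orthogonal under scaling, and the square
  sum of column \<open>j\<close> of the stacked matrix is \<open>c\<^sub>j\<^sup>2 + d\<^sub>j\<^sup>2\<close>, which is \<open>2 + 0\<close> for the first \<open>n - 1\<close>
  columns and \<open>2/(n+1) + 2n/(n+1)\<close> for the others. All entries of \<open>D\<close> have squared modulus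
  \<open>1/(2n)\<close>, so that the square sum of a row is the mean of the \<open>c\<^sub>j\<^sup>2\<close> or of the \<open>d\<^sub>j\<^sup>2\<close>, and both
  means equal 1.

  The reason for the failure of uniform Rieszability is that a row of the upper block
  has all but little of its mass in only \<open>n - 1\<close> coordinates, while there are \<open>2n\<close> such rows. One
  part of any partition into two parts contains at least \<open>n\<close> of them
  (pigeonhole), and \<open>n\<close> vectors in dimension \<open>n - 1\<close> are linearly dependent. Hence some
  nontrivial combination of these rows vanishes on the first \<open>n - 1\<close> coordinates. On the other
  coordinates the rows are those of \<open>D\<close> scaled by the square root of \<open>2/(n+1)\<close>, and the rows of
  \<open>D\<close> are orthonormal, so the combination with coefficients \<open>a\<^sub>i\<close> has squared norm exactly
  \<open>2/(n+1)\<close> times the sum of the \<open>|a\<^sub>i|\<^sup>2\<close> (\<open>Bmat_upper_rows_small_combination\<close>). Thus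
  every admissible \<open>\<delta>\<close> is at most \<open>2/(n+1)\<close> (\<open>rieszable_Bmat_rows_bound\<close>), which tends to 0.
\<close>

section \<open>Homogeneous linear systems with fewer equations than unknowns\<close>

text \<open>
  Gaussian elimination: solving the last equation for an unknown \<open>p\<close> that occurs in it leaves
  one equation and one unknown less.
\<close>

lemma underdetermined_system_nontrivial_solution:
  fixes c :: "'i \<Rightarrow> nat \<Rightarrow> 'a :: field"
  assumes "finite S" and "m < card S"
  shows "\<exists>a. (\<exists>i\<in>S. a i \<noteq> 0) \<and> (\<forall>j<m. (\<Sum>i\<in>S. a i * c i j) = 0)"
  using assms
proof (induction m arbitrary: S c)
  case 0
  then have "S \<noteq> {}" by auto
  then show ?case by (intro exI[of _ "\<lambda>_. 1"]) auto
next
  case (Suc m)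
  show ?case
  proof (cases "\<forall>i\<in>S. c i m = 0")
    case True
    from Suc.IH[of S c] Suc.prems obtain a where
      "\<exists>i\<in>S. a i \<noteq> 0" "\<forall>j<m. (\<Sum>i\<in>S. a i * c i j) = 0" by auto
    with True show ?thesis by (intro exI[of _ a]) (auto simp: less_Suc_eq)
  next
    case False
    then obtain p where p: "p \<in> S" "c p m \<noteq> 0" by auto
    define S' where "S' = S - {p}"
    have S': "finite S'" "m < card S'" "p \<notin> S'" "S = insert p S'"
      using Suc.prems p by (auto simp: S'_def)
    \<comment> \<open>Subtracting multiples of the pivot's coefficients makes the last equation trivial
      on the other unknowns.\<close>
    obtain a where a: "\<exists>i\<in>S'. a i \<noteq> 0"
        "\<And>j. j < m \<Longrightarrow> (\<Sum>i\<in>S'. a i * (c i j - c i m / c p m * c p j)) = 0"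
      using Suc.IH[of S' "\<lambda>i j. c i j - c i m / c p m * c p j"] S' by auto
    \<comment> \<open>The value at the pivot is the one that solves the last equation.\<close>
    define b where "b = a(p := - (\<Sum>i\<in>S'. a i * c i m) / c p m)"
    have b: "(\<Sum>i\<in>S. b i * c i j) = (\<Sum>i\<in>S'. a i * (c i j - c i m / c p m * c p j))" for j
    proof -
      have "(\<Sum>i\<in>S. b i * c i j) = b p * c p j + (\<Sum>i\<in>S'. b i * c i j)"
        using S' by simp
      also have "(\<Sum>i\<in>S'. b i * c i j) = (\<Sum>i\<in>S'. a i * c i j)"
        using S' by (intro sum.cong) (auto simp: b_def)
      also have "b p * c p j = - (\<Sum>i\<in>S'. a i * (c i m / c p m * c p j))"
        by (simp add: b_def sum_distrib_right sum_divide_distrib mult.assoc)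
      finally show ?thesis
        by (simp add: right_diff_distrib sum_subtractf)
    qed
    have "(\<Sum>i\<in>S. b i * c i j) = 0" if "j < Suc m" for j
      using that a(2) p(2) by (cases "j = m") (simp_all add: b)
    moreover have "\<exists>i\<in>S. b i \<noteq> 0"
      using a(1) S' by (auto simp: b_def)
    ultimately show ?thesis by blast
  qed
qed

section \<open>Unitarity of the discrete Fourier transform\<close>

lemma primitive_root_unity_norm:
  assumes "primitive_root_unity m w" and "m \<ge> 1"
  shows "cmod w = 1"
proof -
  have "w ^ m = 1"
    using assms(1) by (simp add: primitive_root_unity_def)
  then show ?thesis
    using assms(2) power_eq_1_iff[of w m] by auto
qed

text \<open>
  On the unit circle conjugation is inversion, so the product is \<open>w\<close> to the power \<open>i - k\<close>, and
  the exponent is strictly between \<open>-m\<close> and \<open>m\<close>.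
\<close>

lemma primitive_root_unity_mult_cnj_powers_neq_1:
  assumes w: "primitive_root_unity m w" and "i < m" "k < m" "i \<noteq> k"
  shows "w ^ i * cnj (w ^ k) \<noteq> 1"
  using assms(2-)
proof (induction i k rule: linorder_wlog)
  case (sym i k)
  have "cnj (w ^ i * cnj (w ^ k)) = w ^ k * cnj (w ^ i)"
    by (simp add: mult.commute)
  moreover have "w ^ k * cnj (w ^ i) \<noteq> 1"
    using sym by blast
  ultimately show ?case
    by (metis complex_cnj_one)
next
  case (le i k)
  have cw: "w * cnj w = 1"
    using primitive_root_unity_norm[OF w] le by (simp add: complex_norm_square[symmetric])
  have "w ^ k * (w ^ i * cnj (w ^ k)) = w ^ i * (w * cnj w) ^ k"
    by (simp add: power_mult_distrib)
  then have eq: "w ^ k * (w ^ i * cnj (w ^ k)) = w ^ i" by (simp add: cw)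
  have "w ^ k = w ^ i * w ^ (k - i)"
    using le by (simp flip: power_add)
  moreover have "w ^ (k - i) \<noteq> 1"
    using w le by (auto simp: primitive_root_unity_def)
  moreover have "w ^ i \<noteq> 0"
    using cw by auto
  ultimately show ?case using eq by auto
qed

lemma DFT_index:
  "i < m \<Longrightarrow> j < m \<Longrightarrow>
    DFT m w $$ (i, j) = complex_of_real (1 / sqrt (real m)) * w ^ ((i + 1) * (j + 1))"
  by (simp add: DFT_def)

lemma DFT_symmetric: "i < m \<Longrightarrow> j < m \<Longrightarrow> DFT m w $$ (i, j) = DFT m w $$ (j, i)"
  by (simp add: DFT_index mult.commute)

lemma norm_DFT_entry:
  assumes "primitive_root_unity m w" and "i < m" "j < m"
  shows "(cmod (DFT m w $$ (i, j)))\<^sup>2 = 1 / m"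
  using assms primitive_root_unity_norm[of m w]
  by (simp add: DFT_index norm_mult norm_power norm_divide power_divide)

text \<open>
  The inner product of two rows is a sum over all powers of an \<open>m\<close>-th root of unity \<open>z\<close>. For
  distinct rows \<open>z\<close> differs from 1, and the geometric sum vanishes.
\<close>

lemma DFT_rows_orthonormal:
  assumes w: "primitive_root_unity m w" and i: "i < m" and k: "k < m"
  shows "(\<Sum>j<m. DFT m w $$ (i, j) * cnj (DFT m w $$ (k, j))) = of_bool (i = k)"
proof -
  define z where "z = w ^ (i + 1) * cnj (w ^ (k + 1))"
  have cw: "w * cnj w = 1"
    using primitive_root_unity_norm[OF w] i by (simp add: complex_norm_square[symmetric])
  let ?s = "complex_of_real (1 / sqrt (real m))"
  have "?s * ?s = complex_of_real (1 / real m)"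
    by (simp only: of_real_mult[symmetric]) simp
  moreover have zpow: "z ^ (j + 1) = w ^ ((i + 1) * (j + 1)) * cnj (w ^ ((k + 1) * (j + 1)))" for j
    by (simp only: z_def power_mult_distrib power_mult complex_cnj_power)
  have "DFT m w $$ (i, j) * cnj (DFT m w $$ (k, j)) = ?s * ?s * z ^ (j + 1)" if "j < m" for j
    unfolding zpow using that i k
    by (simp only: DFT_index complex_cnj_mult complex_cnj_complex_of_real mult_ac)
  ultimately have "DFT m w $$ (i, j) * cnj (DFT m w $$ (k, j)) = z ^ (j + 1) / m" if "j < m" for j
    using that by simp
  then have sum: "(\<Sum>j<m. DFT m w $$ (i, j) * cnj (DFT m w $$ (k, j))) = z * (\<Sum>j<m. z ^ j) / m"
    by (simp add: sum_distrib_left sum_divide_distrib)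
  show ?thesis
  proof (cases "i = k")
    case True
    then have "z = (w * cnj w) ^ (k + 1)"
      by (simp only: z_def power_mult_distrib complex_cnj_power)
    then have "z = 1" by (simp only: cw power_one)
    then show ?thesis unfolding sum using True i by simp
  next
    case False
    have "w ^ m = 1" using w by (simp add: primitive_root_unity_def)
    then have root: "(w ^ l) ^ m = 1" for l
      by (metis mult.commute power_mult power_one)
    have "z ^ m = (w ^ (i + 1)) ^ m * cnj ((w ^ (k + 1)) ^ m)"
      by (simp only: z_def power_mult_distrib complex_cnj_power)
    then have "z ^ m = 1"
      by (simp only: root complex_cnj_one mult_1)
    moreover have "z = w ^ i * cnj (w ^ k) * (w * cnj w)"
      by (simp add: z_def)
    then have "z \<noteq> 1"
      using primitive_root_unity_mult_cnj_powers_neq_1[OF w i k False] by (simp only: cw mult_1_right) simp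
    ultimately have "(\<Sum>j<m. z ^ j) = 0"
      by (simp add: sum_gp_strict)
    with False show ?thesis by (simp add: sum)
  qed
qed

lemma DFT_columns_orthonormal:
  assumes "primitive_root_unity m w" and "j < m" "k < m"
  shows "(\<Sum>i<m. DFT m w $$ (i, j) * cnj (DFT m w $$ (i, k))) = of_bool (j = k)"
  using DFT_rows_orthonormal[OF assms] assms(2,3)
  by (simp add: DFT_symmetric[of _ m j] DFT_symmetric[of _ m k])

text \<open>Parseval's identity for the orthonormal rows.\<close>

lemma DFT_row_combination_norm:
  assumes w: "primitive_root_unity m w" and S: "S \<subseteq> {..<m}"
  shows "(\<Sum>j<m. (cmod (\<Sum>i\<in>S. a i * DFT m w $$ (i, j)))\<^sup>2) = (\<Sum>i\<in>S. (cmod (a i))\<^sup>2)"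
proof -
  let ?D = "\<lambda>i j. DFT m w $$ (i, j)"
  have fin: "finite S" using S finite_subset by blast
  have "complex_of_real (\<Sum>j<m. (cmod (\<Sum>i\<in>S. a i * ?D i j))\<^sup>2) =
      (\<Sum>j<m. \<Sum>i\<in>S. \<Sum>k\<in>S. a i * cnj (a k) * (?D i j * cnj (?D k j)))"
    by (simp only: of_real_sum complex_norm_square cnj_sum sum_product complex_cnj_mult ac_simps)
  also have "\<dots> = (\<Sum>i\<in>S. \<Sum>k\<in>S. a i * cnj (a k) * (\<Sum>j<m. ?D i j * cnj (?D k j)))"
    unfolding sum_distrib_left by (subst sum.swap) (intro sum.cong refl sum.swap)
  also have "\<dots> = (\<Sum>i\<in>S. \<Sum>k\<in>S. if i = k then a i * cnj (a k) else 0)"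
    using S by (intro sum.cong refl) (auto simp: DFT_rows_orthonormal[OF w] subset_iff)
  also have "\<dots> = complex_of_real (\<Sum>i\<in>S. (cmod (a i))\<^sup>2)"
    using fin by (simp add: complex_norm_square del: of_real_power)
  finally show ?thesis unfolding of_real_eq_iff .
qed

section \<open>The stacked matrix\<close>

lemma Bmat_dims [simp]: "dim_row (Bmat n w) = 4 * n" "dim_col (Bmat n w) = 2 * n"
  using Bmat_carrier[of n w] by auto

lemma Bmat_upper:
  assumes "i < 2 * n" "j < 2 * n"
  shows "Bmat n w $$ (i, j) =
    complex_of_real (if j < n - 1 then sqrt 2 else sqrt (2 / (real n + 1))) * DFT (2 * n) w $$ (i, j)"
  using assms by (simp add: Bmat_def B1_def B2_def scale_cols_def append_rows_def DFT_def)

lemma Bmat_lower: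
  assumes "i < 2 * n" "j < 2 * n"
  shows "Bmat n w $$ (2 * n + i, j) =
    complex_of_real (if j < n - 1 then 0 else sqrt (2 * real n / (real n + 1)))
      * DFT (2 * n) w $$ (i, j)"
  using assms by (simp add: Bmat_def B1_def B2_def scale_cols_def append_rows_def DFT_def)

lemma sum_stacked:
  fixes f :: "nat \<Rightarrow> 'a :: comm_monoid_add"
  shows "(\<Sum>i<4 * n. f i) = (\<Sum>i<2 * n. f i) + (\<Sum>i<2 * n. f (2 * n + i))"
proof -
  have "(\<Sum>i<2 * n. f (2 * n + i)) = sum f {2 * n..<4 * n}"
    by (rule sum.reindex_bij_witness[of _ "\<lambda>i. i - 2 * n" "\<lambda>i. 2 * n + i"]) auto
  moreover have "{..<4 * n} = {..<2 * n} \<union> {2 * n..<4 * n}" by auto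
  ultimately show ?thesis by (simp add: sum.union_disjoint disjoint_iff)
qed

text \<open>
  Each block contributes a multiple of the Gram matrix of the Fourier columns, which is the
  identity; on the diagonal the two factors add up to 2.
\<close>

lemma Bmat_column_gram:
  assumes w: "primitive_root_unity (2 * n) w" and j: "j < 2 * n" and k: "k < 2 * n"
  shows "(\<Sum>i<4 * n. Bmat n w $$ (i, j) * cnj (Bmat n w $$ (i, k))) = (if j = k then 2 else 0)"
proof -
  let ?c = "\<lambda>j. if j < n - 1 then sqrt 2 else sqrt (2 / (real n + 1))"
  let ?d = "\<lambda>j. if j < n - 1 then 0 else sqrt (2 * real n / (real n + 1))"
  let ?D = "DFT (2 * n) w"
  let ?G = "\<Sum>i<2 * n. ?D $$ (i, j) * cnj (?D $$ (i, k))"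
  have upper: "(\<Sum>i<2 * n. Bmat n w $$ (i, j) * cnj (Bmat n w $$ (i, k)))
      = complex_of_real (?c j * ?c k) * ?G"
    unfolding sum_distrib_left using j k
    by (intro sum.cong refl) (simp only: Bmat_upper lessThan_iff complex_cnj_mult
        complex_cnj_complex_of_real of_real_mult ac_simps)
  have lower: "(\<Sum>i<2 * n. Bmat n w $$ (2 * n + i, j) * cnj (Bmat n w $$ (2 * n + i, k)))
      = complex_of_real (?d j * ?d k) * ?G"
    unfolding sum_distrib_left using j k
    by (intro sum.cong refl) (simp only: Bmat_lower lessThan_iff complex_cnj_mult
        complex_cnj_complex_of_real of_real_mult, simp only: ac_simps)
  have "(\<Sum>i<4 * n. Bmat n w $$ (i, j) * cnj (Bmat n w $$ (i, k))) =
      complex_of_real (?c j * ?c k + ?d j * ?d k) * ?G"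
    by (simp only: sum_stacked upper lower of_real_add distrib_right)
  also have "\<dots> = (if j = k then complex_of_real ((?c j)\<^sup>2 + (?d j)\<^sup>2) else 0)"
    by (simp add: DFT_columns_orthonormal[OF w j k] power2_eq_square)
  also have "(?c j)\<^sup>2 + (?d j)\<^sup>2 = 2"
  proof -
    have "2 / (real n + 1) + 2 * real n / (real n + 1) = 2"
      by (simp add: field_simps add_nonneg_eq_0_iff)
    then show ?thesis by simp
  qed
  finally show ?thesis by simp
qed

lemma corthogonal_cols_Bmat:
  assumes "primitive_root_unity (2 * n) w"
  shows "corthogonal (cols (Bmat n w))"
  unfolding corthogonal_def
  using Bmat_column_gram[OF assms]
  by (simp add: scalar_prod_def atLeast0LessThan)

lemma Bmat_column_square_sum:
  assumes "primitive_root_unity (2 * n) w" and "j < 2 * n"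
  shows "(\<Sum>i<4 * n. (cmod (Bmat n w $$ (i, j)))\<^sup>2) = 2"
proof -
  have "complex_of_real (\<Sum>i<4 * n. (cmod (Bmat n w $$ (i, j)))\<^sup>2) = complex_of_real 2"
    using Bmat_column_gram[OF assms assms(2)] by (simp add: complex_norm_square del: of_real_power)
  then show ?thesis unfolding of_real_eq_iff .
qed

lemma sum_split_first_columns:
  fixes x y :: real
  assumes "n \<ge> 1"
  shows "(\<Sum>j<2 * n. if j < n - 1 then x else y) = (real n - 1) * x + (real n + 1) * y"
proof -
  have "{..<2 * n} \<inter> {j. j < n - 1} = {..<n - 1}" "{..<2 * n} \<inter> - {j. j < n - 1} = {n - 1..<2 * n}"
    by auto
  moreover have "2 * n - (n - 1) = n + 1" using assms by simp
  ultimately show ?thesis using assms by (simp add: sum.If_cases of_nat_diff add.commute)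
qed

lemma Bmat_row_square_sum:
  assumes w: "primitive_root_unity (2 * n) w" and n: "n \<ge> 1" and i: "i < 4 * n"
  shows "(\<Sum>j<2 * n. (cmod (Bmat n w $$ (i, j)))\<^sup>2) = 1"
proof (cases "i < 2 * n")
  case True
  have "(\<Sum>j<2 * n. (cmod (Bmat n w $$ (i, j)))\<^sup>2) =
      (\<Sum>j<2 * n. if j < n - 1 then 1 / n else 1 / ((real n + 1) * n))"
    using True by (intro sum.cong refl)
      (auto simp: Bmat_upper norm_mult power_mult_distrib norm_DFT_entry[OF w])
  also have "\<dots> = 1"
    using n by (simp only: sum_split_first_columns) (simp add: field_simps add_nonneg_eq_0_iff)
  finally show ?thesis .
next
  case False
  define l where "l = i - 2 * n"
  have l: "i = 2 * n + l" "l < 2 * n" using False i by (auto simp: l_def)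
  have "(\<Sum>j<2 * n. (cmod (Bmat n w $$ (i, j)))\<^sup>2) =
      (\<Sum>j<2 * n. if j < n - 1 then 0 else 1 / (real n + 1))"
    using l n by (intro sum.cong refl)
      (auto simp: Bmat_lower norm_mult power_mult_distrib norm_DFT_entry[OF w])
  also have "\<dots> = 1"
    using n by (simp only: sum_split_first_columns) simp
  finally show ?thesis .
qed

section \<open>Failure of uniform Rieszability\<close>

lemma norm_sq_finsum_vec:
  assumes "finite A" and "\<And>i. i \<in> A \<Longrightarrow> f i \<in> carrier_vec d"
  shows "norm_sq (finsum_vec TYPE(complex) d f A) = (\<Sum>j<d. (cmod (\<Sum>i\<in>A. f i $ j))\<^sup>2)"
proof -
  have f: "f \<in> A \<rightarrow> carrier_vec d" using assms(2) by auto
  then have "dim_vec (finsum_vec TYPE(complex) d f A) = d"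
    using finsum_vec_closed[OF f] by auto
  then show ?thesis
    unfolding norm_sq_def using index_finsum_vec[OF assms(1) _ f] by simp
qed

text \<open>
  The rows in \<open>S\<close> have a nontrivial linear relation on the first \<open>n - 1\<close> coordinates, and on the
  others the entries carry the small factor, so Parseval's identity gives the norm.
\<close>

lemma Bmat_upper_rows_small_combination:
  assumes w: "primitive_root_unity (2 * n) w" and n: "n \<ge> 1"
    and S: "S \<subseteq> {..<2 * n}" and card: "n \<le> card S"
  obtains a where "0 < (\<Sum>i\<in>S. (cmod (a i))\<^sup>2)"
    and "(\<Sum>j<2 * n. (cmod (\<Sum>i\<in>S. a i * Bmat n w $$ (i, j)))\<^sup>2)
      = 2 / (real n + 1) * (\<Sum>i\<in>S. (cmod (a i))\<^sup>2)"
proof -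
  let ?D = "\<lambda>i j. DFT (2 * n) w $$ (i, j)"
  have fin: "finite S" using S finite_subset by blast
  have lt: "n - 1 < card S" using card n by simp
  obtain a where nz: "\<exists>i\<in>S. a i \<noteq> 0"
    and ker: "\<And>j. j < n - 1 \<Longrightarrow> (\<Sum>i\<in>S. a i * ?D i j) = 0"
    using underdetermined_system_nontrivial_solution[OF fin lt, of ?D] by blast
  have "(cmod (\<Sum>i\<in>S. a i * Bmat n w $$ (i, j)))\<^sup>2
      = 2 / (real n + 1) * (cmod (\<Sum>i\<in>S. a i * ?D i j))\<^sup>2" if j: "j < 2 * n" for j
  proof -
    let ?c = "if j < n - 1 then sqrt 2 else sqrt (2 / (real n + 1))"
    have "(\<Sum>i\<in>S. a i * Bmat n w $$ (i, j)) = complex_of_real ?c * (\<Sum>i\<in>S. a i * ?D i j)"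
      unfolding sum_distrib_left using S j
      by (intro sum.cong refl) (auto simp: Bmat_upper)
    then show ?thesis
      using ker[of j] by (simp add: norm_mult power_mult_distrib del: of_real_divide)
  qed
  then have "(\<Sum>j<2 * n. (cmod (\<Sum>i\<in>S. a i * Bmat n w $$ (i, j)))\<^sup>2)
      = 2 / (real n + 1) * (\<Sum>i\<in>S. (cmod (a i))\<^sup>2)"
    using DFT_row_combination_norm[OF w S, of a]
    by (simp flip: sum_distrib_left sum_divide_distrib)
  moreover have "0 < (\<Sum>i\<in>S. (cmod (a i))\<^sup>2)"
    using nz fin by (auto intro: sum_pos2)
  ultimately show ?thesis using that by simp
qed

text \<open>
  One of the two parts contains at least half of the \<open>2n\<close> upper rows; the other rows of that
  part get the coefficient 0.
\<close>

lemma rieszable_Bmat_rows_bound: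
  assumes w: "primitive_root_unity (2 * n) w" and n: "n \<ge> 1"
    and riesz: "rieszable (2 * n) (4 * n) (row (Bmat n w)) \<delta> 2"
  shows "\<delta> \<le> 2 / (real n + 1)"
proof -
  obtain A :: "nat \<Rightarrow> nat set" where cover: "(\<Union>j<2. A j) = {..<4 * n}"
    and bound: "\<And>j a. j < 2 \<Longrightarrow>
      \<delta> * (\<Sum>i\<in>A j. (cmod (a i))\<^sup>2)
        \<le> norm_sq (finsum_vec TYPE(complex) (2 * n) (\<lambda>i. a i \<cdot>\<^sub>v row (Bmat n w) i) (A j))"
    using riesz unfolding rieszable_def by blast
  have "{..<2 :: nat} = {0, 1}" by auto
  then have parts: "A 0 \<union> A 1 = {..<4 * n}" using cover by simp
  have half: "(A 0 \<inter> {..<2 * n}) \<union> (A 1 \<inter> {..<2 * n}) = {..<2 * n}"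
    by (simp only: Int_Un_distrib2[symmetric] parts) auto
  have "2 * n \<le> card (A 0 \<inter> {..<2 * n}) + card (A 1 \<inter> {..<2 * n})"
    using card_Un_le[of "A 0 \<inter> {..<2 * n}" "A 1 \<inter> {..<2 * n}"]
    by (simp only: half card_lessThan)
  then have "n \<le> card (A 0 \<inter> {..<2 * n}) \<or> n \<le> card (A 1 \<inter> {..<2 * n})" by linarith
  then obtain p where "p = 0 \<or> p = 1" and card: "n \<le> card (A p \<inter> {..<2 * n})" by blast
  then have p: "p < 2" by auto
  define S where "S = A p \<inter> {..<2 * n}"
  have S: "S \<subseteq> {..<2 * n}" "S \<subseteq> A p" "n \<le> card S"
    using card by (auto simp: S_def)
  have sub: "A p \<subseteq> {..<4 * n}" using cover p by auto
  have fin: "finite (A p)" using sub by (rule finite_subset) simp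
  obtain a where pos: "0 < (\<Sum>i\<in>S. (cmod (a i))\<^sup>2)"
    and eq: "(\<Sum>j<2 * n. (cmod (\<Sum>i\<in>S. a i * Bmat n w $$ (i, j)))\<^sup>2)
      = 2 / (real n + 1) * (\<Sum>i\<in>S. (cmod (a i))\<^sup>2)"
    using Bmat_upper_rows_small_combination[OF w n S(1,3)] by blast
  define b where "b i = (if i \<in> S then a i else 0)" for i
  have coeffs: "(\<Sum>i\<in>A p. (cmod (b i))\<^sup>2) = (\<Sum>i\<in>S. (cmod (a i))\<^sup>2)"
    using fin S(2) by (intro sum.mono_neutral_cong_right) (auto simp: b_def)
  have comb: "(\<Sum>i\<in>A p. (b i \<cdot>\<^sub>v row (Bmat n w) i) $ j) = (\<Sum>i\<in>S. a i * Bmat n w $$ (i, j))"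
    if "j < 2 * n" for j
  proof -
    have entry: "(b i \<cdot>\<^sub>v row (Bmat n w) i) $ j = b i * Bmat n w $$ (i, j)" if "i \<in> A p" for i
      using subsetD[OF sub that] \<open>j < 2 * n\<close> by simp
    have "(b i \<cdot>\<^sub>v row (Bmat n w) i) $ j = 0" if "i \<in> A p - S" for i
      using entry[of i] that by (simp add: b_def)
    moreover have "(b i \<cdot>\<^sub>v row (Bmat n w) i) $ j = a i * Bmat n w $$ (i, j)" if "i \<in> S" for i
      using entry[of i] subsetD[OF S(2) that] that by (simp add: b_def)
    ultimately show ?thesis
      by (intro sum.mono_neutral_cong_right fin S(2)) blast+
  qed
  have "\<delta> * (\<Sum>i\<in>S. (cmod (a i))\<^sup>2)
      \<le> norm_sq (finsum_vec TYPE(complex) (2 * n) (\<lambda>i. b i \<cdot>\<^sub>v row (Bmat n w) i) (A p))"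
    using bound[OF p, of b] by (simp only: coeffs)
  also have "\<dots> = (\<Sum>j<2 * n. (cmod (\<Sum>i\<in>A p. (b i \<cdot>\<^sub>v row (Bmat n w) i) $ j))\<^sup>2)"
    by (rule norm_sq_finsum_vec[OF fin], rule carrier_vecI)
       (simp only: index_smult_vec index_row Bmat_dims)
  also have "\<dots> = (\<Sum>j<2 * n. (cmod (\<Sum>i\<in>S. a i * Bmat n w $$ (i, j)))\<^sup>2)"
    by (rule sum.cong[OF refl]) (simp only: comb lessThan_iff)
  also note eq
  finally show ?thesis
    by (rule mult_right_le_imp_le[OF _ pos])
qed

theorem proposition3p1:
  fixes \<omega> :: "nat \<Rightarrow> complex"
  assumes "\<And>m. m \<ge> 1 \<Longrightarrow> primitive_root_unity m (\<omega> m)"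
  shows "(\<forall>n\<ge>1.
            corthogonal (cols (Bmat n (\<omega> (2 * n)))) \<and>
            (\<forall>j<2 * n. (\<Sum>i<4 * n. (cmod (Bmat n (\<omega> (2 * n)) $$ (i, j)))\<^sup>2) = 2) \<and>
            (\<forall>i<4 * n. (\<Sum>j<2 * n. (cmod (Bmat n (\<omega> (2 * n)) $$ (i, j)))\<^sup>2) = 1)) \<and>
         \<not> (\<exists>\<delta>>0. \<forall>n\<ge>1. rieszable (2 * n) (4 * n) (row (Bmat n (\<omega> (2 * n)))) \<delta> 2)"
proof -
  have root: "primitive_root_unity (2 * n) (\<omega> (2 * n))" if "n \<ge> 1" for n
    using assms that by simp
  have "\<not> (\<forall>n\<ge>1. rieszable (2 * n) (4 * n) (row (Bmat n (\<omega> (2 * n)))) \<delta> 2)" if "\<delta> > 0" for \<delta>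
  proof
    assume "\<forall>n\<ge>1. rieszable (2 * n) (4 * n) (row (Bmat n (\<omega> (2 * n)))) \<delta> 2"
    then have le: "\<delta> \<le> 2 / (real n + 1)" if "n \<ge> 1" for n
      using rieszable_Bmat_rows_bound[OF root] that by blast
    obtain n where n: "2 / \<delta> < real n" using reals_Archimedean2 by blast
    have "0 < 2 / \<delta>" using that by simp
    then have "n \<ge> 1" using n by (cases n) auto
    from le[OF this] that n show False by (simp add: field_simps)
  qed
  then show ?thesis
    using corthogonal_cols_Bmat[OF root] Bmat_column_square_sum[OF root]
      Bmat_row_square_sum[OF root] by auto
qed

end
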